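(* There exists a domain $D\subset\mathbb{R}^2$ lying in the half-space $\{(x_1,x_2)\in\mathbb{R}^2 : x_2>0\}$ that has Property (J-P)$_{\mathrm{aff}}$ and for which the tube domain $T_D=D+i\mathbb{R}^2\subset\mathbb{C}^2$ is not Kobayashi-hyperbolic. Moreover, such a domain $D$ can be chosen to have a $C^\infty$-smooth boundary.
   Context: For a domain $D\subset\mathbb{R}^n$, the tube domain with base $D$ is $T_D:=D+i\mathbb{R}^n\subset\mathbb{C}^n$. A connected complex manifold $X$ is called Kobayashi-hyperbolic (or simply hyperbolic) if the Kobayashi pseudodistance on $X$ is a distance. If $X$ is endowed with a Riemannian metric, this is equivalent to the following property: for every point $x\in X$ there exist a neighborhood $U$ of $x$ and a constant $M>0$ such that for all holomorphic maps $f:\Delta\to X$ with $f(0)\in U$ one has $\|df(0)\|<M$, where $\Delta$ is the open unit disk in $\mathbb{C}$. For a tube domain $T_D\subset\mathbb{C}^n$, hyperbolicity is equivalent to the following condition: for every point $x\in D$ there exist a neighborhood $U$ of $x$ in $D$ and a constant $M>0$ such that for all harmonic maps $f:\Delta\to D$ (i.e. maps with harmonic components) with $f(0)\in U$ one has $\|df(0)\|<M$. Property (J-P)$_{\mathrm{aff}}$: a domain $D\subset\mathbb{R}^2$ lying in the half-space $\{x_2>0\}$ has Property (J-P)$_{\mathrm{aff}}$ if there does not exist a point $a=(a_1,a_2)\in D$ such that for every $k\in\mathbb{N}$ one can find an affine function $\gamma_k(t)=c_kt+d_k$ (with $c_k,d_k\in\mathbb{R}$) satisfying $(t,\gamma_k(t))\in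 D$ and $|\gamma_k(t)-a_2|\le 1/k$ for all $t\in[-k,k]$. Here $\mathbb{N}$ denotes the positive integers. *)

theory Defs
  imports "HOL-Complex_Analysis.Complex_Analysis"
begin

definition is_domain :: "'a::topological_space set \<Rightarrow> bool" where
  "is_domain D \<longleftrightarrow> D \<noteq> {} \<and> open D \<and> connected D"

definition tube :: "(real ^ 'n) set \<Rightarrow> (complex ^ 'n) set" where
  "tube D = {(\<chi> j. complex_of_real (x $ j) + \<i> * complex_of_real (y $ j)) | x y. x \<in> D}"

(* Distance of the Poincare metric |dz| / (1 - |z|^2).  Other normalisations differ by
   a positive constant factor, which does not affect hyperbolicity. *)
definition poincare_dist :: "complex \<Rightarrow> complex \<Rightarrow> real" where
  "poincare_dist a b = artanh (cmod ((a - b) / (1 - cnj a * b)))"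

definition holomorphic_disc :: "(complex ^ 'n) set \<Rightarrow> (complex \<Rightarrow> complex ^ 'n) \<Rightarrow> bool" where
  "holomorphic_disc X f \<longleftrightarrow>
     (\<forall>j. (\<lambda>z. f z $ j) holomorphic_on ball 0 1) \<and> f ` ball 0 1 \<subseteq> X"

(* Infimum over all chains of m holomorphic discs in X joining p to q.  For a domain X and
   p, q in X, chains exist, so the infimum is that of a nonempty set bounded below by 0. *)
definition kobayashi_dist :: "(complex ^ 'n) set \<Rightarrow> complex ^ 'n \<Rightarrow> complex ^ 'n \<Rightarrow> real" where
  "kobayashi_dist X p q = Inf {(\<Sum>j<m. poincare_dist (a j) (b j)) | m s f a b.
     0 < m \<and> s 0 = p \<and> s m = q \<and>
     (\<forall>j<m. holomorphic_disc X (f j) \<and> a j \<in> ball 0 1 \<and> b j \<in> ball 0 1 \<and>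
            f j (a j) = s j \<and> f j (b j) = s (Suc j))}"

(* On a domain, kobayashi_dist is a pseudodistance, so it is a distance precisely when it
   separates points. *)
definition kobayashi_hyperbolic :: "(complex ^ 'n) set \<Rightarrow> bool" where
  "kobayashi_hyperbolic X \<longleftrightarrow>
     (\<forall>p\<in>X. \<forall>q\<in>X. kobayashi_dist X p q = 0 \<longrightarrow> p = q)"

definition JP_aff :: "(real ^ 2) set \<Rightarrow> bool" where
  "JP_aff D \<longleftrightarrow>
     \<not> (\<exists>a\<in>D. \<forall>k::nat. k \<ge> 1 \<longrightarrow> (\<exists>c d. \<forall>t\<in>{- real k..real k}.
          (vector [t, c * t + d] :: real ^ 2) \<in> D \<and> \<bar>c * t + d - a $ 2\<bar> \<le> 1 / real k))"

(* C^k on an open set U: all iterated partial derivatives up to order k exist and are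
   continuous on U. *)
fun Ck_on :: "nat \<Rightarrow> ('a::euclidean_space \<Rightarrow> real) \<Rightarrow> 'a set \<Rightarrow> bool" where
  "Ck_on 0 f U \<longleftrightarrow> continuous_on U f"
| "Ck_on (Suc k) f U \<longleftrightarrow> f differentiable_on U \<and>
     (\<forall>b\<in>Basis. Ck_on k (\<lambda>x. frechet_derivative f (at x) b) U)"

(* Local C^infinity defining functions with nowhere vanishing differential; in particular
   D lies locally on one side of its boundary. *)
definition smooth_boundary :: "'a::euclidean_space set \<Rightarrow> bool" where
  "smooth_boundary D \<longleftrightarrow> (\<forall>p\<in>frontier D. \<exists>U \<rho>. open U \<and> p \<in> U \<and>
     (\<forall>k. Ck_on k \<rho> U) \<and>
     (\<forall>x\<in>U. frechet_derivative \<rho> (at x) \<noteq> (\<lambda>v. 0)) \<and>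
     D \<inter> U = {x \<in> U. \<rho> x < 0} \<and> frontier D \<inter> U = {x \<in> U. \<rho> x = 0})"

end

theory Submission imports Defs begin

text \<open>
  The domain is the sinusoidal strip \<open>\<bar>x\<^sub>2 - 3 - sin x\<^sub>1\<bar> < 1\<close>. Over \<open>x\<^sub>1 = -\<pi>/2, \<pi>/2, 3\<pi>/2\<close> it lies
  below, above and below the level 3, so it contains no segment over an interval through these
  points. However, it contains all points \<open>(x, 3 + s sin x)\<close> with \<open>0 < s < 2\<close>, hence the real parts
  \<open>(x, 3 + \<epsilon> exp (-y) sin x)\<close> of the holomorphic maps \<open>z \<mapsto> (z, 3 - \<i>\<epsilon>(exp (\<i>z) - 1))\<close> on the disc of
  radius \<open>R\<close> when \<open>\<epsilon> = exp (-R)\<close>. These take the values \<open>(0, 3)\<close> and \<open>(2\<pi>, 3)\<close> at \<open>0\<close> and \<open>2\<pi>\<close>, whose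
  Poincare distance in that disc tends to 0 as \<open>R\<close> grows.
\<close>

section \<open>Geometry of the sinusoidal strip and the affine property\<close>

definition sine_height :: "real ^ 2 \<Rightarrow> real" where
  "sine_height x = x $ 2 - 3 - sin (x $ 1)"

definition sine_strip :: "(real ^ 2) set" where
  "sine_strip = {x. \<bar>sine_height x\<bar> < 1}"

lemma continuous_on_sine_height: "continuous_on A sine_height"
  unfolding sine_height_def by (intro continuous_intros)

lemma sine_height_add_axis:
  "sine_height (x + t *\<^sub>R axis 2 1) = sine_height x + t"
  by (simp add: sine_height_def axis_def)

lemma open_sine_strip: "open sine_strip"
  unfolding sine_strip_def
  by (intro open_Collect_less continuous_on_rabs continuous_on_sine_height continuous_on_const)

text \<open>A continuous vertical shear \<open>h\<close> carries the convex flat strip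
  \<open>S\<close> onto the sinusoidal one.\<close>

lemma connected_sine_strip: "connected sine_strip"
proof -
  define h :: "real ^ 2 \<Rightarrow> real ^ 2" where
    "h x = x + (3 + sin (x $ 1)) *\<^sub>R axis 2 1" for x
  define S :: "(real ^ 2) set" where "S = {x. x $ 2 < 1} \<inter> {x. x $ 2 > -1}"
  have "convex S"
    unfolding S_def
    using convex_halfspace_lt[of "axis 2 1 :: real ^ 2" 1] convex_halfspace_gt[of "-1" "axis 2 1 :: real ^ 2"]
    by (intro convex_Int) (simp_all add: inner_axis')
  moreover have "continuous_on S h"
    unfolding h_def by (intro continuous_intros)
  ultimately have "connected (h ` S)"
    by (intro connected_continuous_image convex_connected)
  moreover have "h ` S = sine_strip"
  proof
    show "h ` S \<subseteq> sine_strip"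
      by (auto simp: h_def S_def sine_strip_def sine_height_def axis_def)
    show "sine_strip \<subseteq> h ` S"
    proof
      fix x assume x: "x \<in> sine_strip"
      let ?y = "x - (3 + sin (x $ 1)) *\<^sub>R axis 2 1"
      have "x = h ?y" by (simp add: h_def axis_def)
      moreover have "?y \<in> S"
        using x by (auto simp: S_def sine_strip_def sine_height_def axis_def)
      ultimately show "x \<in> h ` S" by blast
    qed
  qed
  ultimately show ?thesis by simp
qed

lemma is_domain_sine_strip: "is_domain sine_strip"
proof -
  have "vector [0, 3] \<in> sine_strip"
    by (simp add: sine_strip_def sine_height_def)
  then show ?thesis
    unfolding is_domain_def using open_sine_strip connected_sine_strip by blast
qed

lemma sine_strip_upper_half_plane: "sine_strip \<subseteq> {x. x $ 2 > 0}"
proof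
  fix x :: "real ^ 2" assume "x \<in> sine_strip"
  then have "\<bar>x $ 2 - 3 - sin (x $ 1)\<bar> < 1"
    by (simp add: sine_strip_def sine_height_def)
  with sin_ge_minus_one[of "x $ 1"] show "x \<in> {x. x $ 2 > 0}"
    unfolding mem_Collect_eq by linarith
qed

lemma JP_aff_sine_strip: "JP_aff sine_strip"
  unfolding JP_aff_def
proof clarify
  fix a :: "real ^ 2"
  assume *: "\<forall>k::nat. k \<ge> 1 \<longrightarrow> (\<exists>c d. \<forall>t\<in>{- real k..real k}.
    (vector [t, c * t + d] :: real ^ 2) \<in> sine_strip \<and> \<bar>c * t + d - a $ 2\<bar> \<le> 1 / real k)"
  \<comment> \<open>Here \<open>k = 5\<close> is large enough: the three abscissae lie in
    \<open>[-5, 5]\<close>, since \<open>pi < 16/5\<close> gives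
    \<open>3 * pi / 2 < 24/5\<close>.\<close>
  obtain c d where cd: "\<And>t. t \<in> {- 5..5} \<Longrightarrow> (vector [t, c * t + d] :: real ^ 2) \<in> sine_strip"
    using *[rule_format, of 5] by (simp only: of_nat_numeral) force
  have strip: "\<bar>c * t + d - 3 - sin t\<bar> < 1" if "t \<in> {- 5..5}" for t
    using cd[OF that] by (simp add: sine_strip_def sine_height_def)
  have pi: "0 < pi" "pi < 16/5"
    using pi_gt_zero pi_approx by simp_all
  have "sin (3 * pi / 2) = -1"
    using sin_3over2_pi by simp
  then have "c * (3 * pi / 2) + d < 3"
    using strip[of "3 * pi / 2"] pi by (simp add: abs_less_iff)
  moreover have "c * (pi / 2) + d > 3"
    using strip[of "pi / 2"] pi by (simp add: abs_less_iff)
  moreover have "c * (- (pi / 2)) + d < 3"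
    using strip[of "- (pi / 2)"] pi by (simp add: abs_less_iff)
  \<comment> \<open>As \<open>pi / 2\<close> is the midpoint of the other two abscissae, the affine
    value there is the mean of two numbers below 3, yet it exceeds 3.\<close>
  ultimately show False
    by (simp add: field_simps)
qed

section \<open>Bounds for the Kobayashi distance\<close>

lemma poincare_dist_nonneg:
  assumes "a \<in> ball 0 1" "b \<in> ball 0 1"
  shows "poincare_dist a b \<ge> 0"
proof -
  \<comment> \<open>Up to sign the quotient is a disc automorphism evaluated at \<open>b\<close>, so
    its modulus falls in the range where \<open>artanh\<close> is nonnegative.\<close>
  have "cmod ((b - a) / (1 - cnj a * b)) < 1"
    using Moebius_function_norm_lt_1[of a b 0] assms
    by (simp add: Moebius_function_def)
  then have "cmod ((a - b) / (1 - cnj a * b)) < 1"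
    by (simp add: norm_divide norm_minus_commute)
  moreover have "artanh x \<ge> 0" if "0 \<le> x" "x < 1" for x :: real
    using that by (simp add: artanh_def field_simps)
  ultimately show ?thesis
    unfolding poincare_dist_def by simp
qed

text \<open>A single disc is a chain of length one, and the set of chain lengths is bounded below by
  0, so its infimum is at most this member.\<close>

lemma kobayashi_dist_le_disc:
  assumes f: "holomorphic_disc X f" and ab: "a \<in> ball 0 1" "b \<in> ball 0 1"
  shows "kobayashi_dist X (f a) (f b) \<le> poincare_dist a b"
proof -
  define K where "K = {(\<Sum>j<m. poincare_dist (a' j) (b' j)) | m s g a' b'.
     0 < m \<and> s 0 = f a \<and> s m = f b \<and>
     (\<forall>j<m. holomorphic_disc X (g j) \<and> a' j \<in> ball 0 1 \<and> b' j \<in> ball 0 1 \<and>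
            g j (a' j) = s j \<and> g j (b' j) = s (Suc j))}"
  have "bdd_below K"
    by (rule bdd_belowI[of _ 0]) (auto simp: K_def intro!: sum_nonneg poincare_dist_nonneg)
  moreover have "poincare_dist a b \<in> K"
    unfolding K_def mem_Collect_eq
    by (rule exI[of _ 1], rule exI[of _ "\<lambda>j. if j = 0 then f a else f b"], rule exI[of _ "\<lambda>_. f"],
        rule exI[of _ "\<lambda>_. a"], rule exI[of _ "\<lambda>_. b"]) (use f ab in auto)
  ultimately show ?thesis
    unfolding kobayashi_dist_def K_def[symmetric] by (intro cInf_lower)
qed

text \<open>A lower bound passes to a real \<open>Inf\<close> only for a nonempty set; the disc
  \<open>f\<close> supplies the required chain.\<close>

lemma kobayashi_dist_disc_nonneg:
  assumes f: "holomorphic_disc X f" and ab: "a \<in> ball 0 1" "b \<in> ball 0 1"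
  shows "kobayashi_dist X (f a) (f b) \<ge> 0"
  unfolding kobayashi_dist_def
proof (rule cInf_greatest, goal_cases)
  case 1
  have "\<exists>m s g a' b'. 0 < (m::nat) \<and> s 0 = f a \<and> s m = f b \<and>
     (\<forall>j<m. holomorphic_disc X (g j) \<and> a' j \<in> ball 0 1 \<and> b' j \<in> ball 0 1 \<and>
            g j (a' j) = s j \<and> g j (b' j) = s (Suc j))"
    by (rule exI[of _ 1], rule exI[of _ "\<lambda>j. if j = 0 then f a else f b"], rule exI[of _ "\<lambda>_. f"],
        rule exI[of _ "\<lambda>_. a"], rule exI[of _ "\<lambda>_. b"]) (use f ab in auto)
  then show ?case by blast
next
  case (2 x)
  then show ?case by (auto intro!: sum_nonneg poincare_dist_nonneg)
qed

section \<open>Holomorphic discs in the tube and failure of hyperbolicity\<close>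

lemma mem_tube_iff: "w \<in> tube D \<longleftrightarrow> (\<chi> j. Re (w $ j)) \<in> D"
proof
  assume "w \<in> tube D"
  then show "(\<chi> j. Re (w $ j)) \<in> D"
    by (auto simp: tube_def)
next
  assume *: "(\<chi> j. Re (w $ j)) \<in> D"
  have "w = (\<chi> j. complex_of_real ((\<chi> j. Re (w $ j)) $ j) + \<i> * complex_of_real ((\<chi> j. Im (w $ j)) $ j))"
    by (simp add: vec_eq_iff complex_eq[symmetric])
  with * show "w \<in> tube D"
    unfolding tube_def by blast
qed

text \<open>The disc of radius \<open>R\<close> is rescaled to the unit disc. Subtracting 1 shifts
  only the imaginary part and makes the value at 0 independent of \<open>R\<close>.\<close>

definition sine_disc :: "real \<Rightarrow> complex \<Rightarrow> complex ^ 2" where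
  "sine_disc R z = vector [R * z, 3 - \<i> * exp (- R) * (exp (\<i> * (R * z)) - 1)]"

lemma holomorphic_disc_sine_disc:
  assumes "R > 0"
  shows "holomorphic_disc (tube sine_strip) (sine_disc R)"
  unfolding holomorphic_disc_def
proof (intro conjI allI subsetI)
  fix j :: 2
  have "(\<lambda>z. sine_disc R z $ 1) holomorphic_on ball 0 1"
    "(\<lambda>z. sine_disc R z $ 2) holomorphic_on ball 0 1"
    unfolding sine_disc_def vector_2 by (intro holomorphic_intros)+
  then show "(\<lambda>z. sine_disc R z $ j) holomorphic_on ball 0 1"
    using exhaust_2[of j] by auto
next
  fix w assume "w \<in> sine_disc R ` ball 0 1"
  then obtain z where z: "cmod z < 1" and w: "w = sine_disc R z" by auto
  define x where "x = R * Re z"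
  \<comment> \<open>This is \<open>exp (- R)\<close> times the modulus of
    \<open>exp (\<i> * (R * z))\<close>; the exponent is negative because
    \<open>Im z > -1\<close>.\<close>
  define s where "s = exp (- R - R * Im z)"
  have "\<bar>Im z\<bar> < 1"
    using abs_Im_le_cmod[of z] z by linarith
  then have "R * (-1) < R * Im z"
    using assms by (intro mult_strict_left_mono) auto
  then have s: "0 < s" "s < 1"
    by (simp_all add: s_def)
  have "Re (w $ 1) = x"
    by (simp add: w sine_disc_def x_def)
  moreover have "Re (w $ 2) = 3 + s * sin x"
    by (simp add: w sine_disc_def x_def s_def Im_exp Re_exp exp_add[symmetric] exp_of_real exp_diff exp_minus field_simps)
  moreover have "\<bar>s * sin x - sin x\<bar> < 1"
  proof -
    have "\<bar>s * sin x - sin x\<bar> = \<bar>(s - 1) * sin x\<bar>"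
      by (simp add: left_diff_distrib)
    also have "\<dots> = (1 - s) * \<bar>sin x\<bar>"
      using s by (simp add: abs_mult)
    also have "\<dots> \<le> (1 - s) * 1"
      using s by (intro mult_left_mono) auto
    finally show ?thesis using s by simp
  qed
  ultimately show "w \<in> tube sine_strip"
    by (simp add: mem_tube_iff sine_strip_def sine_height_def)
qed

lemma not_kobayashi_hyperbolic_sine_strip: "\<not> kobayashi_hyperbolic (tube sine_strip)"
proof
  assume hyp: "kobayashi_hyperbolic (tube sine_strip)"
  define p q :: "complex ^ 2" where "p = vector [0, 3]" and "q = vector [2 * pi, 3]"
  have p: "p = sine_disc R 0" for R
    by (simp add: p_def sine_disc_def)
  \<comment> \<open>By periodicity of \<open>exp\<close> the second coordinate returns to 3, so all
    these discs pass through the same two points.\<close>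
  have q: "q = sine_disc R (2 * pi / R)" if "R > 0" for R
    using that exp_two_pi_i by (simp add: q_def sine_disc_def mult_ac)
  have ball: "complex_of_real (2 * pi / R) \<in> ball 0 1" if "R > 2 * pi" for R
  proof -
    have "0 < R" using that pi_gt_zero by linarith
    then show ?thesis
      using that by (simp add: norm_divide norm_mult)
  qed
  have pos: "R > 0" if "R > 2 * pi" for R
    using that pi_gt_zero by linarith
  have disc: "holomorphic_disc (tube sine_strip) (sine_disc R)" if "R > 2 * pi" for R
    using holomorphic_disc_sine_disc pos that by blast
  have upper: "kobayashi_dist (tube sine_strip) p q \<le> artanh (2 * pi / R)" if R: "R > 2 * pi" for R
  proof -
    have "kobayashi_dist (tube sine_strip) p q \<le> poincare_dist 0 (complex_of_real (2 * pi / R))"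
      using kobayashi_dist_le_disc[OF disc[OF R] _ ball[OF R], of 0] p q[OF pos[OF R]] by simp
    also have "\<dots> = artanh (2 * pi / R)"
      using pos[OF R] by (simp add: poincare_dist_def norm_divide norm_mult)
    finally show ?thesis .
  qed
  \<comment> \<open>Letting \<open>R\<close> grow squeezes the fixed distance from \<open>p\<close>
    to \<open>q\<close> down to \<open>artanh 0 = 0\<close>.\<close>
  have "((\<lambda>R. artanh (2 * pi / R)) \<longlongrightarrow> artanh 0) at_top"
    by (intro tendsto_artanh real_tendsto_divide_at_top filterlim_ident tendsto_const) auto
  moreover have "\<forall>\<^sub>F R in at_top. kobayashi_dist (tube sine_strip) p q \<le> artanh (2 * pi / R)"
    using eventually_gt_at_top[of "2 * pi"] by eventually_elim (rule upper)
  ultimately have "kobayashi_dist (tube sine_strip) p q \<le> artanh 0"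
    by (intro tendsto_lowerbound) auto
  moreover have "kobayashi_dist (tube sine_strip) p q \<ge> 0"
    \<comment> \<open>Any one disc through both points will do; \<open>R = 8\<close> is admissible
      because \<open>pi < 4\<close>.\<close>
    using kobayashi_dist_disc_nonneg[OF disc _ ball, of 8 0 8] pi_less_4 p[of 8] q[of 8] by simp
  moreover have "p \<in> tube sine_strip" "q \<in> tube sine_strip"
    by (simp_all add: mem_tube_iff sine_strip_def sine_height_def p_def q_def)
  ultimately have "p = q"
    using hyp unfolding kobayashi_hyperbolic_def by simp
  then have "p $ 1 = q $ 1" by simp
  then show False by (simp add: p_def q_def)
qed

section \<open>The boundary and its smoothness\<close>

lemma frontier_sine_strip: "frontier sine_strip = {x. \<bar>sine_height x\<bar> = 1}"
proof -
  have "closure sine_strip = {x. \<bar>sine_height x\<bar> \<le> 1}"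
  proof
    have "closed {x. \<bar>sine_height x\<bar> \<le> 1}"
      by (intro closed_Collect_le continuous_on_rabs continuous_on_sine_height continuous_on_const)
    then show "closure sine_strip \<subseteq> {x. \<bar>sine_height x\<bar> \<le> 1}"
      by (intro closure_minimal) (auto simp: sine_strip_def)
    show "{x. \<bar>sine_height x\<bar> \<le> 1} \<subseteq> closure sine_strip"
    proof
      fix x assume "x \<in> {x. \<bar>sine_height x\<bar> \<le> 1}"
      then have x: "\<bar>sine_height x\<bar> \<le> 1" by simp
      \<comment> \<open>Moving vertically towards the central curve multiplies the height by
        \<open>1 - 1 / (n + 1)\<close>, so the approximating points lie strictly inside.\<close>
      define y where "y n = x + (- sine_height x / real (Suc n)) *\<^sub>R axis 2 1" for n
      have "y n \<in> sine_strip" for n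
      proof -
        have "\<bar>sine_height (y n)\<bar> = \<bar>sine_height x * (1 - 1 / real (Suc n))\<bar>"
          unfolding y_def sine_height_add_axis by (simp add: right_diff_distrib del: of_nat_Suc)
        also have "\<dots> = \<bar>sine_height x\<bar> * (1 - 1 / real (Suc n))"
          by (simp add: abs_mult)
        also have "\<dots> \<le> 1 * (1 - 1 / real (Suc n))"
          using x by (intro mult_right_mono) auto
        also have "\<dots> < 1" by simp
        finally show ?thesis by (simp add: sine_strip_def)
      qed
      moreover have "y \<longlonglongrightarrow> x + 0 *\<^sub>R axis 2 1"
        unfolding y_def
        by (intro tendsto_intros LIMSEQ_Suc[OF lim_const_over_n])
      ultimately show "x \<in> closure sine_strip"
        unfolding closure_sequential by auto
    qed
  qed
  then show ?thesis
    using open_sine_strip by (auto simp: frontier_def interior_open sine_strip_def)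
qed

lemma has_derivative_affine_trig:
  fixes v :: "real ^ 2"
  shows "((\<lambda>x. c + v \<bullet> x + A * sin (x $ 1) + B * cos (x $ 1)) has_derivative
    (\<lambda>h. v \<bullet> h + (A * cos (x $ 1) - B * sin (x $ 1)) * h $ 1)) (at x)"
  by (auto intro!: derivative_eq_intros bounded_linear_imp_has_derivative simp: algebra_simps)

text \<open>This family is closed under directional derivatives, which only change the coefficients;
  hence the induction keeps them arbitrary.\<close>

lemma Ck_on_affine_trig:
  fixes v :: "real ^ 2"
  shows "Ck_on k (\<lambda>x. c + v \<bullet> x + A * sin (x $ 1) + B * cos (x $ 1)) U"
proof (induction k arbitrary: c v A B)
  case 0
  show ?case by (auto intro!: continuous_intros)
next
  case (Suc k)
  have "(\<lambda>x. c + v \<bullet> x + A * sin (x $ 1) + B * cos (x $ 1)) differentiable_on U"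
    by (intro differentiable_at_imp_differentiable_on differentiableI[OF has_derivative_affine_trig])
  moreover have "Ck_on k (\<lambda>x. frechet_derivative
      (\<lambda>x. c + v \<bullet> x + A * sin (x $ 1) + B * cos (x $ 1)) (at x) b) U" for b
    using Suc.IH[of "v \<bullet> b" 0 "- B * b $ 1" "A * b $ 1"]
    unfolding frechet_derivative_at[OF has_derivative_affine_trig, symmetric]
    by (simp add: algebra_simps)
  ultimately show ?case by simp
qed

lemma smooth_boundary_sine_strip: "smooth_boundary sine_strip"
  unfolding smooth_boundary_def
proof
  fix p assume "p \<in> frontier sine_strip"
  then have p: "\<bar>sine_height p\<bar> = 1"
    by (simp add: frontier_sine_strip)
  define \<sigma> where "\<sigma> = sine_height p"
  define \<rho> where "\<rho> x = \<sigma> * sine_height x - 1" for x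
  \<comment> \<open>On \<open>U\<close> the height has the sign \<open>\<sigma>\<close> of its value
    at \<open>p\<close>, so its absolute value is \<open>\<sigma> * sine_height x\<close>, and the
    other boundary curve is excluded.\<close>
  define U where "U = {x. \<sigma> * sine_height x > 0}"
  have \<sigma>: "\<sigma> = 1 \<or> \<sigma> = -1"
    using p unfolding \<sigma>_def by linarith
  have \<rho>: "\<rho> = (\<lambda>x. (- 3 * \<sigma> - 1) + (\<sigma> *\<^sub>R axis 2 1) \<bullet> x + (- \<sigma>) * sin (x $ 1) + 0 * cos (x $ 1))"
    by (auto simp: \<rho>_def sine_height_def inner_axis' algebra_simps)
  have "open U"
    unfolding U_def
    by (intro open_Collect_less continuous_on_mult continuous_on_sine_height continuous_on_const)
  moreover have "p \<in> U"
    using \<sigma> by (auto simp: U_def \<sigma>_def)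
  moreover have "Ck_on k \<rho> U" for k
    unfolding \<rho> by (rule Ck_on_affine_trig)
  moreover have "frechet_derivative \<rho> (at x) \<noteq> (\<lambda>v. 0)" for x
  proof
    assume "frechet_derivative \<rho> (at x) = (\<lambda>v. 0)"
    \<comment> \<open>The vertical derivative of \<open>\<rho>\<close> is the constant
      \<open>\<sigma>\<close>, which is nonzero.\<close>
    then have "frechet_derivative \<rho> (at x) (axis 2 1) = 0" by simp
    then show False
      using \<sigma> unfolding \<rho> frechet_derivative_at[OF has_derivative_affine_trig, symmetric]
      by (auto simp: inner_axis_axis, simp_all add: axis_def)
  qed
  moreover have "sine_strip \<inter> U = {x \<in> U. \<rho> x < 0}"
    using \<sigma> by (auto simp: sine_strip_def U_def \<rho>_def)
  moreover have "frontier sine_strip \<inter> U = {x \<in> U. \<rho> x = 0}"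
    using \<sigma> by (auto simp: frontier_sine_strip U_def \<rho>_def)
  ultimately show "\<exists>U \<rho>. open U \<and> p \<in> U \<and> (\<forall>k. Ck_on k \<rho> U) \<and>
     (\<forall>x\<in>U. frechet_derivative \<rho> (at x) \<noteq> (\<lambda>v. 0)) \<and>
     sine_strip \<inter> U = {x \<in> U. \<rho> x < 0} \<and> frontier sine_strip \<inter> U = {x \<in> U. \<rho> x = 0}"
    by blast
qed

theorem theorem1p2:
  "\<exists>D :: (real ^ 2) set.
     is_domain D \<and> D \<subseteq> {x. x $ 2 > 0} \<and> JP_aff D \<and>
     \<not> kobayashi_hyperbolic (tube D) \<and> smooth_boundary D"
  using is_domain_sine_strip sine_strip_upper_half_plane JP_aff_sine_strip
    not_kobayashi_hyperbolic_sine_strip smooth_boundary_sine_strip by blast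

end
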